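(* Let $U$ be a (real, $n\times n$) potential matrix and let $f:\mathbb{R}_+\to\mathbb{R}_+$ be a nonnegative strictly increasing convex function. Let $f(U)$ denote the matrix with entries $f(U)_{ij}=f(U_{ij})$. Then $f(U)$ is nonsingular, $\det(f(U))>0$, and $f(U)$ has a nonnegative right equilibrium potential (i.e. a vector $\mu\ge 0$ with $f(U)\mu=\mathbf 1$). Moreover, if $f(0)=0$, then $M=U^{-1}f(U)$ is an $M$-matrix. If in addition $U$ is a bi-potential, then $f(U)$ also has a nonnegative left equilibrium potential (i.e. a vector $\nu\ge 0$ with $\nu' f(U)=\mathbf 1'$).
   Context: All matrices are real and square; inequalities between vectors or matrices are entrywise; $'$ denotes transpose; $\mathbf 1$ is the vector of ones; $\mathbb{R}_+=[0,\infty)$. An $M$-matrix here means a nonsingular matrix with nonpositive off-diagonal entries whose inverse is entrywise nonnegative. A nonnegative matrix $U$ is a potential if it is nonsingular and $(U^{-1})_{ij}\le 0$ for $i\ne j$, $(U^{-1})_{ii}>0$, and $\sum_j (U^{-1})_{ij}\ge 0$ for every $i$. It is a bi-potential if in addition $\sum_i (U^{-1})_{ij}\ge 0$ for every $j$ (equivalently, both $U$ and $U'$ are potentials). *)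

theory Defs
  imports "HOL-Analysis.Analysis"
begin

definition nonneg_matrix :: "real^'n^'n \<Rightarrow> bool" where
  "nonneg_matrix A \<longleftrightarrow> (\<forall>i j. 0 \<le> A $ i $ j)"

definition M_matrix :: "real^'n^'n \<Rightarrow> bool" where
  "M_matrix M \<longleftrightarrow> invertible M \<and> (\<forall>i j. i \<noteq> j \<longrightarrow> M $ i $ j \<le> 0)
     \<and> nonneg_matrix (matrix_inv M)"

definition potential :: "real^'n^'n \<Rightarrow> bool" where
  "potential U \<longleftrightarrow> nonneg_matrix U \<and> invertible U
     \<and> (\<forall>i j. i \<noteq> j \<longrightarrow> matrix_inv U $ i $ j \<le> 0)
     \<and> (\<forall>i. 0 < matrix_inv U $ i $ i)
     \<and> (\<forall>i. 0 \<le> (\<Sum>j\<in>UNIV. matrix_inv U $ i $ j))"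

definition bi_potential :: "real^'n^'n \<Rightarrow> bool" where
  "bi_potential U \<longleftrightarrow> potential U \<and> (\<forall>j. 0 \<le> (\<Sum>i\<in>UNIV. matrix_inv U $ i $ j))"

(* The vector 1 :: real^'n is the all-ones vector, and \<le> on real^'n is entrywise. *)

definition right_equilibrium_potential :: "real^'n^'n \<Rightarrow> real^'n \<Rightarrow> bool" where
  "right_equilibrium_potential A \<mu> \<longleftrightarrow> A *v \<mu> = 1"

definition left_equilibrium_potential :: "real^'n^'n \<Rightarrow> real^'n \<Rightarrow> bool" where
  "left_equilibrium_potential A \<nu> \<longleftrightarrow> \<nu> v* A = 1"

end

(* For f 0 = 0, the i-th row of inv U exhibits the off-diagonal entry U_ij as a sub-convex combination
   of the other entries of column j, so Jensen's inequality makes M = inv U ** f(U) a Z-matrix. With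
   w = 1' U one gets w > 0 and w' M = 1' f(U) > 0, which is the classical criterion for M to be an
   M-matrix. Determinants of such Z-matrices are positive because the matrices satisfying the criterion
   for a fixed w form a convex set that contains the identity. The equilibrium potential is
   inv M (inv U 1). Adding the constant f 0 to all entries is a rank-one perturbation that only
   rescales the equilibrium potential, and the left-hand version follows by transposition. *)

theory Submission
  imports Defs
begin

section \<open>Z-matrices: nonnegative solutions, inverses and determinants\<close>

definition Z_matrix :: "real^'n^'n \<Rightarrow> bool" where
  "Z_matrix A \<longleftrightarrow> (\<forall>i j. i \<noteq> j \<longrightarrow> A $ i $ j \<le> 0)"

lemma matrix_inv_right:
  fixes A :: "real^'n^'n"
  assumes "invertible A" shows "A ** matrix_inv A = mat 1"
  using someI_ex[OF assms[unfolded invertible_def]] by (simp add: matrix_inv_def)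

lemma matrix_inv_left:
  fixes A :: "real^'n^'n"
  assumes "invertible A" shows "matrix_inv A ** A = mat 1"
  using someI_ex[OF assms[unfolded invertible_def]] by (simp add: matrix_inv_def)

lemma matrix_inv_transpose:
  fixes A :: "real^'n^'n"
  assumes "invertible A"
  shows "matrix_inv (transpose A) = transpose (matrix_inv A)"
proof -
  have "transpose A ** transpose (matrix_inv A) = mat 1"
    using matrix_inv_left[OF assms] by (metis matrix_transpose_mul transpose_mat)
  moreover have "matrix_inv (transpose A) ** transpose A = mat 1"
    by (simp add: matrix_inv_left transpose_invertible assms)
  ultimately show ?thesis
    by (metis matrix_mul_assoc matrix_mul_lid matrix_mul_rid)
qed

lemma invertible_iff_ker:
  fixes A :: "real^'n^'n"
  shows "invertible A \<longleftrightarrow> (\<forall>x. A *v x = 0 \<longrightarrow> x = 0)"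
  by (simp add: invertible_left_inverse matrix_left_invertible_ker)

text \<open>If x had negative coordinates, summing with weights \<open>w\<close> just the rows of A
  x at those coordinates would give a negative number, although each of these rows is nonnegative.
  Invertibility, the sign of the inverse and the sign of the equilibrium potential all follow from
  this.\<close>

lemma Z_matrix_mult_nonneg_imp:
  fixes A :: "real^'n^'n"
  assumes Z: "Z_matrix A" and w: "\<And>i. 0 < w $ i" and wA: "\<And>j. 0 < (w v* A) $ j"
    and Ax: "0 \<le> A *v x"
  shows "0 \<le> x"
proof (rule ccontr)
  assume "\<not> 0 \<le> x"
  define S where "S = {i. x $ i < 0}"
  \<comment> \<open>The weighted column sums restricted to the rows in \<open>S\<close>. Outside
    \<open>S\<close> only off-diagonal entries occur, so \<open>c j\<close> is nonpositive; inside
    \<open>S\<close> the omitted rows contribute nonpositively to \<open>w v* A\<close>, so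
    \<open>c j\<close> stays positive. Each sign is opposite to that of
    \<open>x $ j\<close>.\<close>
  define c where "c j = (\<Sum>i\<in>S. w $ i * A $ i $ j)" for j
  have "S \<noteq> {}"
    using \<open>\<not> 0 \<le> x\<close> by (auto simp: S_def less_eq_vec_def not_le)
  have c_out: "c j \<le> 0" if "j \<notin> S" for j
    unfolding c_def using that Z w
    by (intro sum_nonpos mult_nonneg_nonpos) (auto simp: Z_matrix_def less_imp_le, metis)
  have c_in: "0 < c j" if "j \<in> S" for j
  proof -
    have "(w v* A) $ j = c j + (\<Sum>i\<in>-S. w $ i * A $ i $ j)"
      unfolding c_def vector_matrix_mult_def
      by (simp add: mult.commute sum.subset_diff[of S UNIV] Compl_eq_Diff_UNIV)
    moreover have "(\<Sum>i\<in>-S. w $ i * A $ i $ j) \<le> 0"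
      using that Z w
      by (intro sum_nonpos mult_nonneg_nonpos) (auto simp: Z_matrix_def less_imp_le, metis)
    ultimately show ?thesis using wA[of j] by linarith
  qed
  have "0 \<le> (\<Sum>i\<in>S. w $ i * (A *v x) $ i)"
    using Ax w by (intro sum_nonneg mult_nonneg_nonneg) (auto simp: less_eq_vec_def less_imp_le)
  also have "\<dots> = (\<Sum>j\<in>UNIV. c j * x $ j)"
    unfolding c_def matrix_vector_mult_def sum_distrib_right
    by (subst sum.swap) (simp add: sum_distrib_left mult.assoc)
  also have "\<dots> = (\<Sum>j\<in>S. c j * x $ j) + (\<Sum>j\<in>-S. c j * x $ j)"
    by (simp add: sum.subset_diff[of S UNIV] Compl_eq_Diff_UNIV)
  also have "\<dots> < 0"
  proof -
    have "(\<Sum>j\<in>S. c j * x $ j) < (\<Sum>j\<in>S. 0)"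
      using c_in \<open>S \<noteq> {}\<close> by (intro sum_strict_mono) (auto simp: S_def mult_pos_neg)
    moreover have "(\<Sum>j\<in>-S. c j * x $ j) \<le> 0"
      using c_out by (intro sum_nonpos mult_nonpos_nonneg) (auto simp: S_def)
    ultimately show ?thesis by simp
  qed
  finally show False by simp
qed

lemma Z_matrix_invertible:
  fixes A :: "real^'n^'n"
  assumes "Z_matrix A" "\<And>i. 0 < w $ i" "\<And>j. 0 < (w v* A) $ j"
  shows "invertible A"
  unfolding invertible_iff_ker
proof (intro allI impI)
  fix x assume "A *v x = 0"
  moreover from this have "A *v (- x) = 0"
    using matrix_vector_mult_scaleR[of A "-1" x] by simp
  ultimately have "0 \<le> x" "0 \<le> - x"
    using Z_matrix_mult_nonneg_imp[OF assms] by (metis order_refl)+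
  then show "x = 0"
    by (simp add: less_eq_vec_def vec_eq_iff antisym)
qed

text \<open>Column j of the inverse solves A x = \<open>axis j 1\<close>, whose right-hand side is
  nonnegative.\<close>

lemma Z_matrix_imp_M_matrix:
  fixes A :: "real^'n^'n"
  assumes "Z_matrix A" "\<And>i. 0 < w $ i" "\<And>j. 0 < (w v* A) $ j"
  shows "M_matrix A"
proof -
  have inv: "invertible A" by (rule Z_matrix_invertible[OF assms])
  have "0 \<le> matrix_inv A *v axis j 1" for j
    by (rule Z_matrix_mult_nonneg_imp[OF assms])
      (simp add: matrix_vector_mul_assoc matrix_inv_right inv less_eq_vec_def axis_def)
  then have "nonneg_matrix (matrix_inv A)"
    by (auto simp: nonneg_matrix_def less_eq_vec_def matrix_vector_mult_basis column_def)
  with inv assms(1) show ?thesis by (simp add: M_matrix_def Z_matrix_def)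
qed

text \<open>The determinant is continuous along the segment from A to B and never vanishes on it, so
  it keeps its sign.\<close>

lemma det_pos_of_invertible_segment:
  fixes A B :: "real^'n^'n"
  assumes A: "0 < det A"
    and inv: "\<And>t. 0 \<le> t \<Longrightarrow> t \<le> 1 \<Longrightarrow> invertible ((1 - t) *\<^sub>R A + t *\<^sub>R B)"
  shows "0 < det B"
proof (rule ccontr)
  let ?h = "\<lambda>t. det ((1 - t) *\<^sub>R A + t *\<^sub>R B)"
  assume "\<not> 0 < det B"
  then have "?h 1 \<le> 0" "0 \<le> ?h 0" using A by simp_all
  moreover have "continuous_on {0..1} ?h"
    unfolding det_def by (simp, intro continuous_intros)
  ultimately obtain t where "0 \<le> t" "t \<le> 1" "?h t = 0"
    using IVT2'[of ?h 1 0 0] by auto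
  then show False using inv by (simp add: invertible_det_nz)
qed

lemma Z_matrix_det_pos:
  fixes A :: "real^'n^'n"
  assumes Z: "Z_matrix A" and w: "\<And>i. 0 < w $ i" and wA: "\<And>j. 0 < (w v* A) $ j"
  shows "0 < det A"
proof (rule det_pos_of_invertible_segment)
  show "0 < det (mat 1 :: real^'n^'n)" by simp
  fix t :: real assume t: "0 \<le> t" "t \<le> 1"
  let ?B = "(1 - t) *\<^sub>R mat 1 + t *\<^sub>R A"
  have "Z_matrix ?B"
    using Z t by (auto simp: Z_matrix_def mat_def mult_nonneg_nonpos)
  moreover have "0 < (w v* ?B) $ j" for j
  proof -
    have "(w v* ?B) $ j = (1 - t) * w $ j + t * (w v* A) $ j"
    proof -
      have "(w v* ?B) $ j =
          (\<Sum>i\<in>UNIV. (1 - t) * (if i = j then w $ i else 0) + t * (A $ i $ j * w $ i))"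
        unfolding vector_matrix_mult_def vec_lambda_beta
        by (intro sum.cong) (simp_all add: mat_def algebra_simps)
      also have "\<dots> = (1 - t) * w $ j + t * (w v* A) $ j"
        by (simp add: sum.distrib vector_matrix_mult_def mult.commute flip: sum_distrib_left)
      finally show ?thesis .
    qed
    also have "\<dots> > 0"
    \<comment> \<open>Neither summand is positive for all t: the first vanishes at t = 1, the second
      at t = 0.\<close>
    proof (cases "t = 0")
      case False
      then show ?thesis using t w[of j] wA[of j] by (intro add_nonneg_pos) auto
    qed (simp add: w)
    finally show ?thesis .
  qed
  ultimately show "invertible ?B"
    by (rule Z_matrix_invertible[OF _ w])
qed

section \<open>Potentials and their images under f with f 0 = 0\<close>

lemma potential_diag_pos:
  fixes U :: "real^'n^'n"
  assumes "potential U" shows "0 < U $ i $ i"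
proof (rule ccontr)
  assume "\<not> 0 < U $ i $ i"
  with assms have "U $ i $ i = 0" by (auto simp: potential_def nonneg_matrix_def intro: antisym)
  \<comment> \<open>The only positive entry in row i of the inverse is its diagonal one, and it
    would meet the factor 0. The diagonal entry 1 of the identity would then be a sum of nonpositive
    terms.\<close>
  then have "matrix_inv U $ i $ k * U $ k $ i \<le> 0" for k
    using assms by (cases "k = i") (auto simp: potential_def nonneg_matrix_def mult_nonpos_nonneg)
  then have "(matrix_inv U ** U) $ i $ i \<le> 0"
    by (auto simp: matrix_matrix_mult_def intro: sum_nonpos)
  moreover have "(matrix_inv U ** U) $ i $ i = 1"
    using assms by (simp add: matrix_inv_left potential_def mat_def)
  ultimately show False by simp
qed

lemma nonneg_matrix_col_sum_pos:
  fixes A :: "real^'n^'n"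
  assumes "nonneg_matrix A" "\<And>i. 0 < A $ i $ i"
  shows "0 < (1 v* A) $ j"
proof -
  have "0 < (\<Sum>i\<in>UNIV. A $ i $ j)"
    using assms by (intro sum_pos2[of UNIV j]) (auto simp: nonneg_matrix_def)
  then show ?thesis by (simp add: vector_matrix_mult_def)
qed

text \<open>Evaluates the weight 1' A on products with the inverse of A: \<open>B = mat 1\<close>
  serves the inverse of U itself, \<open>B = map_matrix f U\<close> serves M.\<close>

lemma vector_mult_matrix_inv_mult:
  fixes A B :: "real^'n^'n"
  assumes "invertible A"
  shows "(x v* A) v* (matrix_inv A ** B) = x v* B"
  using assms by (simp add: vector_matrix_mul_assoc matrix_mul_assoc matrix_inv_right)

lemma potential_det_pos:
  fixes U :: "real^'n^'n"
  assumes "potential U" shows "0 < det U"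
proof -
  have inv: "invertible U" using assms by (simp add: potential_def)
  have "0 < det (matrix_inv U)"
  proof (rule Z_matrix_det_pos)
    show "Z_matrix (matrix_inv U)" using assms by (simp add: potential_def Z_matrix_def)
    show "0 < (1 v* U) $ i" for i
      using assms by (intro nonneg_matrix_col_sum_pos potential_diag_pos) (simp_all add: potential_def)
    show "0 < ((1 v* U) v* matrix_inv U) $ j" for j
      using vector_mult_matrix_inv_mult[OF inv, of 1 "mat 1"] by simp
  qed
  moreover have "det (matrix_inv U) * det U = 1"
    using matrix_inv_left[OF inv] by (metis det_mul det_I)
  ultimately show ?thesis by (metis zero_less_mult_pos zero_less_one)
qed

lemma potential_inv_mult_map_Z_matrix:
  fixes U :: "real^'n^'n"
  assumes U: "potential U" and f: "convex_on {0..} f" and f0: "f 0 = 0"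
  shows "Z_matrix (matrix_inv U ** map_matrix f U)"
  unfolding Z_matrix_def
proof (intro allI impI)
  fix i j :: 'n assume ij: "i \<noteq> j"
  define V where "V = matrix_inv U"
  have U0: "0 \<le> U $ k $ l" for k l using U by (simp add: potential_def nonneg_matrix_def)
  have d: "0 < V $ i $ i" using U by (simp add: potential_def V_def)
  have off: "V $ i $ k \<le> 0" if "k \<noteq> i" for k
    using U that by (auto simp: potential_def V_def)
  \<comment> \<open>Row i of the inverse, normalized by its diagonal entry. Off i the weights are
    nonnegative, and the row sum condition bounds their total by 1; at i itself the value is
    -1.\<close>
  define p where "p k = - V $ i $ k / V $ i $ i" for k
  \<comment> \<open>Used for three choices of \<open>g\<close>: the constant 1 bounds the total
    weight, column j of U represents \<open>U $ i $ j\<close>, and the image of that column under f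
    gives the entry of M.\<close>
  have row: "(\<Sum>k\<in>UNIV. V $ i $ k * g k) = V $ i $ i * (g i - (\<Sum>k\<in>-{i}. p k * g k))" for g
  proof -
    have "(\<Sum>k\<in>-{i}. V $ i $ k * g k) = - V $ i $ i * (\<Sum>k\<in>-{i}. p k * g k)"
      using d by (simp add: p_def sum_distrib_left flip: sum_negf)
    then show ?thesis
      by (simp add: sum.remove[of UNIV i] Compl_eq_Diff_UNIV algebra_simps)
  qed
  have "0 \<le> (\<Sum>k\<in>UNIV. V $ i $ k * 1)" using U by (simp add: potential_def V_def)
  then have p1: "(\<Sum>k\<in>-{i}. p k) \<le> 1"
    using d by (subst (asm) row) (simp add: zero_le_mult_iff)
  have "(\<Sum>k\<in>UNIV. V $ i $ k * U $ k $ j) = (V ** U) $ i $ j"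
    by (simp add: matrix_matrix_mult_def)
  also have "\<dots> = 0"
    using U ij by (simp add: V_def matrix_inv_left potential_def mat_def)
  finally have Uij: "U $ i $ j = (\<Sum>k\<in>-{i}. p k * U $ k $ j)"
    using d by (subst (asm) row) simp
  \<comment> \<open>The missing mass is put on the value 0, at the index i that the combination leaves free.\<close>
  define q where "q = p(i := 1 - (\<Sum>k\<in>-{i}. p k))"
  define y where "y = (\<lambda>k. U $ k $ j)(i := 0)"
  have split: "(\<Sum>k\<in>UNIV. q k * g k) = q i * g i + (\<Sum>k\<in>-{i}. p k * g k)" for g
    by (simp add: sum.remove[of UNIV i] Compl_eq_Diff_UNIV q_def)
  have "f (\<Sum>k\<in>UNIV. q k *\<^sub>R y k) \<le> (\<Sum>k\<in>UNIV. q k * f (y k))"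
  proof (rule convex_on_sum[OF _ _ f])
    show "(\<Sum>k\<in>UNIV. q k) = 1"
      using split[of "\<lambda>_. 1"] by (simp add: q_def)
    show "0 \<le> q k" for k
      using p1 off d by (auto simp: q_def p_def divide_nonpos_pos)
  qed (auto simp: y_def U0)
  moreover have "(\<Sum>k\<in>UNIV. q k *\<^sub>R y k) = U $ i $ j"
    unfolding Uij real_scaleR_def split by (simp add: y_def)
  moreover have "(\<Sum>k\<in>UNIV. q k * f (y k)) = (\<Sum>k\<in>-{i}. p k * f (U $ k $ j))"
    unfolding split by (simp add: y_def f0)
  ultimately have "f (U $ i $ j) \<le> (\<Sum>k\<in>-{i}. p k * f (U $ k $ j))" by simp
  then have "(\<Sum>k\<in>UNIV. V $ i $ k * f (U $ k $ j)) \<le> 0"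
    using d by (subst row) (simp add: mult_nonneg_nonpos)
  then show "(matrix_inv U ** map_matrix f U) $ i $ j \<le> 0"
    by (simp add: matrix_matrix_mult_def V_def)
qed

lemma potential_map_zero:
  fixes U :: "real^'n^'n"
  assumes U: "potential U" and f: "f \<in> {0..} \<rightarrow> {0..}" "strict_mono_on {0..} f" "convex_on {0..} f"
    and f0: "f 0 = 0"
  shows "0 < det (map_matrix f U)"
    and "M_matrix (matrix_inv U ** map_matrix f U)"
    and "\<exists>\<mu>. 0 \<le> \<mu> \<and> map_matrix f U *v \<mu> = 1"
proof -
  define M where "M = matrix_inv U ** map_matrix f U"
  have inv: "invertible U" and U0: "nonneg_matrix U" using U by (simp_all add: potential_def)
  have UM: "U ** M = map_matrix f U"
    using inv by (simp add: M_def matrix_mul_assoc matrix_inv_right)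
  have w: "0 < (1 v* U) $ i" for i
    by (intro nonneg_matrix_col_sum_pos U0 potential_diag_pos U)
  have wM: "0 < ((1 v* U) v* M) $ j" for j
    unfolding M_def vector_mult_matrix_inv_mult[OF inv]
  proof (rule nonneg_matrix_col_sum_pos)
    show "nonneg_matrix (map_matrix f U)"
      using U0 f(1) by (auto simp: nonneg_matrix_def)
    \<comment> \<open>Strict monotonicity enters here: a positive diagonal entry of U is sent
      strictly above f 0 = 0.\<close>
    show "0 < map_matrix f U $ i $ i" for i
      using strict_mono_onD[OF f(2), of 0 "U $ i $ i"] potential_diag_pos[OF U, of i] f0 by simp
  qed
  have Z: "Z_matrix M" unfolding M_def by (rule potential_inv_mult_map_Z_matrix[OF U f(3) f0])
  have "0 < det M" by (rule Z_matrix_det_pos[OF Z w wM])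
  then show "0 < det (map_matrix f U)"
    using potential_det_pos[OF U] by (simp add: det_mul flip: UM)
  show "M_matrix (matrix_inv U ** map_matrix f U)"
    using Z_matrix_imp_M_matrix[OF Z w wM] by (simp add: M_def)
  define \<mu> where "\<mu> = matrix_inv M *v (matrix_inv U *v 1)"
  have "M *v \<mu> = (M ** matrix_inv M) *v (matrix_inv U *v 1)"
    unfolding \<mu>_def by (rule matrix_vector_mul_assoc)
  then have M\<mu>: "M *v \<mu> = matrix_inv U *v 1"
    by (simp add: matrix_inv_right Z_matrix_invertible[OF Z w wM])
  \<comment> \<open>The entries of \<open>matrix_inv U *v 1\<close> are the row sums of the inverse,
    nonnegative because U is a potential.\<close>
  then have "0 \<le> M *v \<mu>"
    using U by (simp add: potential_def less_eq_vec_def matrix_vector_mult_def)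
  then have "0 \<le> \<mu>" by (rule Z_matrix_mult_nonneg_imp[OF Z w wM])
  moreover have "map_matrix f U *v \<mu> = U *v (M *v \<mu>)"
    by (simp add: matrix_vector_mul_assoc UM)
  then have "map_matrix f U *v \<mu> = 1"
    by (simp add: M\<mu> matrix_vector_mul_assoc matrix_inv_right inv)
  ultimately show "\<exists>\<mu>. 0 \<le> \<mu> \<and> map_matrix f U *v \<mu> = 1" by blast
qed

section \<open>Adding a constant to all entries\<close>

lemma map_matrix_add_const_mult:
  fixes A :: "real^'n^'n"
  shows "map_matrix (\<lambda>x. x + c) A *v x = A *v x + (c * (\<Sum>i\<in>UNIV. x $ i)) *\<^sub>R 1"
  by (simp add: vec_eq_iff matrix_vector_mult_def algebra_simps sum.distrib sum_distrib_left)

text \<open>With m the total mass of \<mu>, the shifted matrix sends \<mu> to (1 + c m) 1, so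
  dividing \<mu> by 1 + c m gives the new equilibrium potential. The same positive factor excludes a
  kernel.\<close>

lemma map_matrix_add_const_equilibrium:
  fixes A :: "real^'n^'n"
  assumes A: "0 < det A" and \<mu>: "0 \<le> \<mu>" "A *v \<mu> = 1" and c: "0 \<le> c"
  shows "0 < det (map_matrix (\<lambda>x. x + c) A)"
    and "\<exists>\<mu>. 0 \<le> \<mu> \<and> map_matrix (\<lambda>x. x + c) A *v \<mu> = 1"
proof -
  define m where "m = (\<Sum>i\<in>UNIV. \<mu> $ i)"
  have m: "0 \<le> m" using \<mu>(1) by (auto simp: m_def less_eq_vec_def intro: sum_nonneg)
  have A_ker: "x = 0" if "A *v x = 0" for x
    using A that invertible_iff_ker[of A] by (auto simp: invertible_det_nz)
  \<comment> \<open>An arbitrary offset \<open>d\<close> is needed because the segment from A to the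
    shifted matrix runs through all offsets t c with t in [0,1].\<close>
  have inv: "invertible (map_matrix (\<lambda>x. x + d) A)" if d: "0 \<le> d" for d
    unfolding invertible_iff_ker
  proof (intro allI impI)
    fix x assume x: "map_matrix (\<lambda>x. x + d) A *v x = 0"
    define s where "s = (\<Sum>i\<in>UNIV. x $ i)"
    \<comment> \<open>The kernel equation reads A x + (d s) 1 = 0, and 1 = A \<mu>. Hence x is a
      multiple of \<mu>, and summing its coordinates gives s (1 + d m) = 0.\<close>
    have "A *v (x + (d * s) *\<^sub>R \<mu>) = 0"
      using x unfolding map_matrix_add_const_mult
      by (simp add: s_def \<mu>(2) matrix_vector_right_distrib matrix_vector_mult_scaleR)
    then have x_eq: "x = - (d * s) *\<^sub>R \<mu>"
      using A_ker by (fastforce simp: eq_neg_iff_add_eq_0)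
    have "s = (\<Sum>i\<in>UNIV. (- (d * s) *\<^sub>R \<mu>) $ i)"
      unfolding x_eq[symmetric] by (rule s_def)
    then have "s = - (d * s) * m"
      by (simp add: m_def sum_distrib_left sum_negf)
    then have "s * (1 + d * m) = 0" by (simp add: algebra_simps)
    moreover have "1 + d * m > 0" using m d by (simp add: add_pos_nonneg)
    ultimately have "s = 0" by simp
    then show "x = 0" using x_eq by simp
  qed
  show "0 < det (map_matrix (\<lambda>x. x + c) A)"
  proof (rule det_pos_of_invertible_segment[OF A])
    fix t :: real assume "0 \<le> t" "t \<le> 1"
    moreover have "(1 - t) *\<^sub>R A + t *\<^sub>R map_matrix (\<lambda>x. x + c) A = map_matrix (\<lambda>x. x + t * c) A"
      by (simp add: vec_eq_iff algebra_simps)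
    ultimately show "invertible ((1 - t) *\<^sub>R A + t *\<^sub>R map_matrix (\<lambda>x. x + c) A)"
      using inv c by simp
  qed
  have pos: "0 < 1 + c * m" using m c by (simp add: add_pos_nonneg)
  have "map_matrix (\<lambda>x. x + c) A *v \<mu> = (1 + c * m) *\<^sub>R 1"
    unfolding map_matrix_add_const_mult \<mu>(2) m_def by (simp add: algebra_simps)
  then have "map_matrix (\<lambda>x. x + c) A *v (inverse (1 + c * m) *\<^sub>R \<mu>) = 1"
    using pos by (simp add: matrix_vector_mult_scaleR)
  moreover have "0 \<le> inverse (1 + c * m) *\<^sub>R \<mu>"
    using pos \<mu>(1) by (simp add: less_eq_vec_def)
  ultimately show "\<exists>\<mu>. 0 \<le> \<mu> \<and> map_matrix (\<lambda>x. x + c) A *v \<mu> = 1" by blast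
qed

section \<open>General f and the left equilibrium potential\<close>

lemma potential_map:
  fixes U :: "real^'n^'n"
  assumes U: "potential U" and f: "f \<in> {0..} \<rightarrow> {0..}" "strict_mono_on {0..} f" "convex_on {0..} f"
  shows "0 < det (map_matrix f U)"
    and "\<exists>\<mu>. 0 \<le> \<mu> \<and> map_matrix f U *v \<mu> = 1"
proof -
  \<comment> \<open>Subtracting f 0 preserves strict monotonicity and convexity, and monotonicity
    keeps \<open>g\<close> nonnegative. The constant is restored afterwards as a nonnegative
    shift.\<close>
  define g where "g x = f x - f 0" for x
  have "g \<in> {0..} \<rightarrow> {0..}"
    using strict_mono_on_leD[OF f(2)] by (auto simp: g_def)
  moreover have "strict_mono_on {0..} g"
    using f(2) by (auto simp: g_def strict_mono_on_def)
  moreover have "convex_on {0..} g"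
    using convex_on_add[OF f(3), of "\<lambda>_. - f 0"] by (simp add: g_def[abs_def] convex_on_const)
  moreover have "g 0 = 0" by (simp add: g_def)
  ultimately have g: "0 < det (map_matrix g U)" "\<exists>\<mu>. 0 \<le> \<mu> \<and> map_matrix g U *v \<mu> = 1"
    using potential_map_zero[OF U] by blast+
  have eq: "map_matrix f U = map_matrix (\<lambda>x. x + f 0) (map_matrix g U)"
    by (simp add: vec_eq_iff g_def)
  have "0 \<le> f 0" using f(1) by auto
  then show "0 < det (map_matrix f U)" "\<exists>\<mu>. 0 \<le> \<mu> \<and> map_matrix f U *v \<mu> = 1"
    unfolding eq using map_matrix_add_const_equilibrium[OF g(1)] g(2) by blast+
qed

lemma bi_potential_transpose:
  fixes U :: "real^'n^'n"
  assumes "bi_potential U" shows "potential (transpose U)"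
proof -
  have inv: "invertible U" using assms by (simp add: bi_potential_def potential_def)
  have nth: "transpose A $ i $ j = A $ j $ i" for A :: "real^'n^'n" and i j
    by (simp add: transpose_def)
  show ?thesis
    using assms transpose_invertible[OF inv]
    by (auto simp: bi_potential_def potential_def nonneg_matrix_def matrix_inv_transpose[OF inv] nth)
qed

theorem theorem2p1:
  fixes U :: "real^'n^'n" and f :: "real \<Rightarrow> real"
  assumes "potential U"
    and "f \<in> {0..} \<rightarrow> {0..}"
    and "strict_mono_on {0..} f"
    and "convex_on {0..} f"
  shows "invertible (map_matrix f U)
    \<and> 0 < det (map_matrix f U)
    \<and> (\<exists>\<mu>. 0 \<le> \<mu> \<and> right_equilibrium_potential (map_matrix f U) \<mu>)
    \<and> (f 0 = 0 \<longrightarrow> M_matrix (matrix_inv U ** map_matrix f U))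
    \<and> (bi_potential U \<longrightarrow> (\<exists>\<nu>. 0 \<le> \<nu> \<and> left_equilibrium_potential (map_matrix f U) \<nu>))"
proof (intro conjI impI)
  show det: "0 < det (map_matrix f U)" by (rule potential_map[OF assms])
  then show "invertible (map_matrix f U)" by (simp add: invertible_det_nz)
  show "\<exists>\<mu>. 0 \<le> \<mu> \<and> right_equilibrium_potential (map_matrix f U) \<mu>"
    unfolding right_equilibrium_potential_def by (rule potential_map[OF assms])
  show "M_matrix (matrix_inv U ** map_matrix f U)" if "f 0 = 0"
    by (rule potential_map_zero[OF assms that])
  show "\<exists>\<nu>. 0 \<le> \<nu> \<and> left_equilibrium_potential (map_matrix f U) \<nu>" if "bi_potential U"
  proof -
    \<comment> \<open>Hence a right equilibrium potential for the image of the transpose is a left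
      one for the image of U.\<close>
    have "map_matrix f (transpose U) = transpose (map_matrix f U)"
      by (simp add: vec_eq_iff transpose_def)
    then show ?thesis
      using potential_map(2)[OF bi_potential_transpose[OF that] assms(2-4)]
      by (simp add: left_equilibrium_potential_def)
  qed
qed

end
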